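(* Let $n\ge 0$ and $m>1$ be integers, and let $d_{n+4}=|D_{n+4}|$. Then $$d_{n+4}\equiv F(D_n^6)\equiv F\big((E^c_{n,m})^6\big)\pmod m$$ and $$d_{n+4}\equiv\sum_{a\in R_n\cap E^c_{n,m}}\ \sum_{b,c,d,e,f\in E^c_{n,m}}\gamma(a)\cdot F(a,b,c,d,e,f)\pmod m.$$
   Context: $D_n$ is the set of monotone Boolean functions $\{0,1\}^n\to\{0,1\}$ ($\{0,1\}^n$ ordered componentwise), partially ordered pointwise. $\top,\bot$ are the constant functions $1,0$; $x|y$ and $x\&y$ are pointwise max and min; $\mathrm{re}(x,y)=|\{z\in D_n:x\le z\le y\}|$. For $a,b,c,d,e,f\in D_n$ define $F(a,b,c,d,e,f)=U\cdot L$, where $$U=\sum_{u\in D_n,\ u\ge a|b|c|d|e|f}\mathrm{re}(a|b|d,u)\,\mathrm{re}(a|c|e,u)\,\mathrm{re}(b|c|f,u)\,\mathrm{re}(d|e|f,u),$$ $$L=\sum_{u\in D_n,\ u\le a\&b\&c\&d\&e\&f}\mathrm{re}(u,a\&b\&c)\,\mathrm{re}(u,a\&d\&e)\,\mathrm{re}(u,b\&d\&f)\,\mathrm{re}(u,c\&e\&f),$$ and for $A\subseteq D_n^6$, $F(A)=\sum_{(a,\dots,f)\in A}F(a,b,c,d,e,f)$. A permutation $\pi\in S_n$ acts on $g\in D_n$ by $\pi(g)=g\circ\pi$ where $\pi(u)=u\circ\pi$ for $u\in\{0,1\}^n$. $f\sim g$ iff $f=\pi(g)$ for some $\pi\in S_n$;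 $[f]$ is the class of $f$, $\gamma(f)=|[f]|$. $E_{n,m}=\{f\in D_n:\gamma(f)\equiv0\pmod m\}$, $E^c_{n,m}=D_n\setminus E_{n,m}$. $R_n$ is the set of equivalence classes, each identified with its canonical representative, namely its minimal element with respect to a fixed total order on $D_n$ (the paper uses the order obtained by reading the truth table as a binary integer); thus $R_n\subseteq D_n$ contains exactly one element of each class. *)

theory Defs
  imports Main "HOL-Library.FuncSet" "HOL-Combinatorics.Permutations" "HOL-Number_Theory.Cong"
begin

unbundle lattice_syntax

text \<open>
  Points of the cube and Boolean functions on it are extensional functions. Two points of the cube
  (or two functions on it) agree outside their domain, so the library's pointwise order and lattice
  operations on functions restrict to the componentwise order on the cube, and to the pointwise
  order, maximum and minimum of Boolean functions.
\<close>

definition cube :: "nat \<Rightarrow> (nat \<Rightarrow> bool) set" where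
  "cube n = {..<n} \<rightarrow>\<^sub>E UNIV"

definition mbf :: "nat \<Rightarrow> ((nat \<Rightarrow> bool) \<Rightarrow> bool) set" where
  "mbf n = {f \<in> cube n \<rightarrow>\<^sub>E UNIV. mono_on (cube n) f}"

definition re :: "nat \<Rightarrow> ((nat \<Rightarrow> bool) \<Rightarrow> bool) \<Rightarrow> ((nat \<Rightarrow> bool) \<Rightarrow> bool) \<Rightarrow> nat" where
  "re n x y = card {z \<in> mbf n. x \<le> z \<and> z \<le> y}"

definition F :: "nat \<Rightarrow> ((nat \<Rightarrow> bool) \<Rightarrow> bool) \<Rightarrow> ((nat \<Rightarrow> bool) \<Rightarrow> bool) \<Rightarrow> ((nat \<Rightarrow> bool) \<Rightarrow> bool)
    \<Rightarrow> ((nat \<Rightarrow> bool) \<Rightarrow> bool) \<Rightarrow> ((nat \<Rightarrow> bool) \<Rightarrow> bool) \<Rightarrow> ((nat \<Rightarrow> bool) \<Rightarrow> bool) \<Rightarrow> nat" where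
  "F n a b c d e f =
     (\<Sum>u \<in> {u \<in> mbf n. a \<squnion> b \<squnion> c \<squnion> d \<squnion> e \<squnion> f \<le> u}.
        re n (a \<squnion> b \<squnion> d) u * re n (a \<squnion> c \<squnion> e) u * re n (b \<squnion> c \<squnion> f) u * re n (d \<squnion> e \<squnion> f) u) *
     (\<Sum>u \<in> {u \<in> mbf n. u \<le> a \<sqinter> b \<sqinter> c \<sqinter> d \<sqinter> e \<sqinter> f}.
        re n u (a \<sqinter> b \<sqinter> c) * re n u (a \<sqinter> d \<sqinter> e) * re n u (b \<sqinter> d \<sqinter> f) * re n u (c \<sqinter> e \<sqinter> f))"

definition F_set :: "nat \<Rightarrow> (((nat \<Rightarrow> bool) \<Rightarrow> bool) \<times> ((nat \<Rightarrow> bool) \<Rightarrow> bool) \<times> ((nat \<Rightarrow> bool) \<Rightarrow> bool) \<times>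
    ((nat \<Rightarrow> bool) \<Rightarrow> bool) \<times> ((nat \<Rightarrow> bool) \<Rightarrow> bool) \<times> ((nat \<Rightarrow> bool) \<Rightarrow> bool)) set \<Rightarrow> nat" where
  "F_set n A = (\<Sum>(a, b, c, d, e, f) \<in> A. F n a b c d e f)"

text \<open>
  If \<open>p\<close> permutes \<open>{..<n}\<close> then precomposition with \<open>p\<close> maps the cube onto itself and its complement
  into itself, so no restriction is needed for the result to be extensional again.
\<close>

definition perm_act :: "(nat \<Rightarrow> nat) \<Rightarrow> ((nat \<Rightarrow> bool) \<Rightarrow> bool) \<Rightarrow> ((nat \<Rightarrow> bool) \<Rightarrow> bool)" where
  "perm_act p g = g \<circ> (\<lambda>u. u \<circ> p)"

definition mbf_equiv :: "nat \<Rightarrow> ((nat \<Rightarrow> bool) \<Rightarrow> bool) rel" where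
  "mbf_equiv n = {(f, g). f \<in> mbf n \<and> g \<in> mbf n \<and> (\<exists>p. p permutes {..<n} \<and> f = perm_act p g)}"

definition \<gamma> :: "nat \<Rightarrow> ((nat \<Rightarrow> bool) \<Rightarrow> bool) \<Rightarrow> nat" where
  "\<gamma> n f = card (mbf_equiv n `` {f})"

definition E :: "nat \<Rightarrow> nat \<Rightarrow> ((nat \<Rightarrow> bool) \<Rightarrow> bool) set" where
  "E n m = {f \<in> mbf n. [\<gamma> n f = 0] (mod m)}"

definition Ec :: "nat \<Rightarrow> nat \<Rightarrow> ((nat \<Rightarrow> bool) \<Rightarrow> bool) set" where
  "Ec n m = mbf n - E n m"

text \<open>The argument \<open>r\<close> is the total order on \<open>mbf n\<close> used to choose canonical representatives.\<close>

definition R :: "nat \<Rightarrow> ((nat \<Rightarrow> bool) \<Rightarrow> bool) rel \<Rightarrow> ((nat \<Rightarrow> bool) \<Rightarrow> bool) set" where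
  "R n r = {a. \<exists>C \<in> mbf n // mbf_equiv n. a \<in> C \<and> (\<forall>b \<in> C. (a, b) \<in> r)}"

unbundle no lattice_syntax

end

theory Submission imports Defs "HOL-Library.Product_Order"
begin

text \<open>
  Fixing the last four variables of a function in \<open>D\<^sub>n\<^sub>+\<^sub>4\<close> gives a monotone map from \<open>{0,1}\<^sup>4\<close> to \<open>D\<^sub>n\<close>.
  Once its six values \<open>a, \<dots>, f\<close> on the middle layer are prescribed, the upper and the lower part of the map
  can be chosen independently. With the top value \<open>u\<close> fixed, the four values below it range freely over
  intervals ending at \<open>u\<close>; dually at the bottom. So there are \<open>F(a, \<dots>, f)\<close> such maps.
  Permuting variables is a lattice automorphism of \<open>D\<^sub>n\<close>, so \<open>F\<close> is invariant under the diagonal action, and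
  the sum of \<open>F\<close> over all tuples with one coordinate fixed depends only on the class of that coordinate.
  A class thus contributes \<open>\<gamma>\<close> times the value at its representative, which vanishes modulo \<open>m\<close> on \<open>E\<^sub>n\<^sub>,\<^sub>m\<close>;
  this discards \<open>E\<^sub>n\<^sub>,\<^sub>m\<close> from one coordinate after the other.
\<close>

unbundle lattice_syntax

section \<open>Comparable pairs and counting maps on the four-dimensional cube\<close>

text \<open>The order must be reflected as well as preserved: a bijection that is merely monotone
  need not induce one on comparable pairs.\<close>

definition order_iso_betw :: "('a::order \<Rightarrow> 'b::order) \<Rightarrow> 'a set \<Rightarrow> 'b set \<Rightarrow> bool" where
  "order_iso_betw f A B \<longleftrightarrow> bij_betw f A B \<and> (\<forall>x\<in>A. \<forall>y\<in>A. f x \<le> f y \<longleftrightarrow> x \<le> y)"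

text \<open>These are the monotone maps from a two-element chain to \<open>A\<close>. Pairs are
  ordered componentwise, so iterating \<open>k\<close> times yields the monotone maps from
  \<open>{0,1}^k\<close> to \<open>A\<close>.\<close>

definition chain_pairs :: "'a::order set \<Rightarrow> ('a \<times> 'a) set" where
  "chain_pairs A = {(x, y). x \<in> A \<and> y \<in> A \<and> x \<le> y}"

lemma mem_chain_pairs [simp]: "(x, y) \<in> chain_pairs A \<longleftrightarrow> x \<in> A \<and> y \<in> A \<and> x \<le> y"
  by (simp add: chain_pairs_def)

lemma order_iso_betw_trans:
  assumes "order_iso_betw f A B" "order_iso_betw g B C"
  shows "order_iso_betw (g \<circ> f) A C"
  using assms unfolding order_iso_betw_def
  by (auto intro: bij_betw_trans simp: bij_betw_apply)

lemma order_iso_betw_chain_pairs: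
  assumes "order_iso_betw f A B"
  shows "order_iso_betw (map_prod f f) (chain_pairs A) (chain_pairs B)"
proof -
  have bij: "bij_betw f A B" and le: "\<And>x y. x \<in> A \<Longrightarrow> y \<in> A \<Longrightarrow> f x \<le> f y \<longleftrightarrow> x \<le> y"
    using assms by (auto simp: order_iso_betw_def)
  have inj: "inj_on f A" and im: "f ` A = B"
    using bij by (auto simp: bij_betw_def)
  have "inj_on (map_prod f f) (chain_pairs A)"
    using inj by (auto simp: inj_on_def chain_pairs_def)
  moreover have "map_prod f f ` chain_pairs A = chain_pairs B"
  proof (intro equalityI subsetI)
    fix q assume "q \<in> chain_pairs B"
    then obtain x y where "q = (f x, f y)" "x \<in> A" "y \<in> A" "f x \<le> f y"
      unfolding im [symmetric] by (auto simp: chain_pairs_def)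
    then show "q \<in> map_prod f f ` chain_pairs A"
      using le by (auto intro!: image_eqI [where x = "(x, y)"])
  qed (auto simp: le im [symmetric])
  ultimately show ?thesis
    using le by (auto simp: order_iso_betw_def bij_betw_def chain_pairs_def)
qed

text \<open>Every chain from the lower layers to the upper ones passes through the middle layer.
  Once the middle layer is fixed, the data above and below it are therefore independent, and each
  summand is a product.\<close>

lemma card_chain_pairs4:
  fixes A :: "'a::lattice set"
  assumes fin: "finite A"
  defines "I \<equiv> \<lambda>x y. {z \<in> A. x \<le> z \<and> z \<le> y}"
  shows "card (chain_pairs (chain_pairs (chain_pairs (chain_pairs A)))) =
    (\<Sum>(a, b, c, d, e, f) \<in> A \<times> A \<times> A \<times> A \<times> A \<times> A.
      (\<Sum>u \<in> {u \<in> A. a \<squnion> b \<squnion> c \<squnion> d \<squnion> e \<squnion> f \<le> u}.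
        card (I (a \<squnion> b \<squnion> d) u) * card (I (a \<squnion> c \<squnion> e) u) *
        card (I (b \<squnion> c \<squnion> f) u) * card (I (d \<squnion> e \<squnion> f) u)) *
      (\<Sum>u \<in> {u \<in> A. u \<le> a \<sqinter> b \<sqinter> c \<sqinter> d \<sqinter> e \<sqinter> f}.
        card (I u (a \<sqinter> b \<sqinter> c)) * card (I u (a \<sqinter> d \<sqinter> e)) *
        card (I u (b \<sqinter> d \<sqinter> f)) * card (I u (c \<sqinter> e \<sqinter> f))))"
proof -
  define Up where "Up = (\<lambda>(a, b, c, d, e, f). SIGMA u : {u \<in> A. a \<squnion> b \<squnion> c \<squnion> d \<squnion> e \<squnion> f \<le> u}.
    I (a \<squnion> b \<squnion> d) u \<times> I (a \<squnion> c \<squnion> e) u \<times> I (b \<squnion> c \<squnion> f) u \<times> I (d \<squnion> e \<squnion> f) u)"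
  define Lo where "Lo = (\<lambda>(a, b, c, d, e, f). SIGMA u : {u \<in> A. u \<le> a \<sqinter> b \<sqinter> c \<sqinter> d \<sqinter> e \<sqinter> f}.
    I u (a \<sqinter> b \<sqinter> c) \<times> I u (a \<sqinter> d \<sqinter> e) \<times> I u (b \<sqinter> d \<sqinter> f) \<times> I u (c \<sqinter> e \<sqinter> f))"
  define S where "S = (SIGMA t : A \<times> A \<times> A \<times> A \<times> A \<times> A. Up t \<times> Lo t)"
  txt \<open>Vertices of the cube are subsets of \<open>{1, 2, 3, 4}\<close>: \<open>a, \<dots>, f\<close> sit at 12, 13, 14, 23, 24, 34,
    \<open>v, w, x, y\<close> at 1, 2, 3, 4, and \<open>p, q, r, s\<close> at 123, 124, 134, 234; element 1 is the innermost pairing.\<close>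
  define g where "g = (\<lambda>((a :: 'a, b :: 'a, c :: 'a, d :: 'a, e :: 'a, f :: 'a),
      (u :: 'a, p :: 'a, q :: 'a, r :: 'a, s :: 'a), (l :: 'a, v :: 'a, w :: 'a, x :: 'a, y :: 'a)).
    ((((l, v), (w, a)), ((x, b), (d, p))), (((y, c), (e, q)), ((f, r), (s, u)))))"
  define g' where "g' = (\<lambda>((((l :: 'a, v :: 'a), (w :: 'a, a :: 'a)), ((x :: 'a, b :: 'a), (d :: 'a, p :: 'a))),
      (((y :: 'a, c :: 'a), (e :: 'a, q :: 'a)), ((f :: 'a, r :: 'a), (s :: 'a, u :: 'a)))).
    ((a, b, c, d, e, f), (u, p, q, r, s), (l, v, w, x, y)))"
  have "bij_betw g S (chain_pairs (chain_pairs (chain_pairs (chain_pairs A))))"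
  proof (rule bij_betw_byWitness [where f' = g'])
    show "\<forall>t \<in> S. g' (g t) = t"
      by (auto simp: g_def g'_def)
    show "\<forall>t \<in> chain_pairs (chain_pairs (chain_pairs (chain_pairs A))). g (g' t) = t"
      by (auto simp: g_def g'_def)
    show "g ` S \<subseteq> chain_pairs (chain_pairs (chain_pairs (chain_pairs A)))"
      by (auto simp: g_def S_def Up_def Lo_def I_def)
    \<comment> \<open>The edges of the cube only give chains such as \<open>a\<close> \<le>
      \<open>p\<close> \<le> \<open>u\<close>; transitivity turns them into the bounds of
      \<open>u\<close> and \<open>l\<close> against all six middle values.\<close>
    show "g' ` chain_pairs (chain_pairs (chain_pairs (chain_pairs A))) \<subseteq> S"
      by (auto simp: g'_def S_def Up_def Lo_def I_def; meson order_trans)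
  qed
  then have "card (chain_pairs (chain_pairs (chain_pairs (chain_pairs A)))) = card S"
    by (metis bij_betw_same_card)
  also have "\<dots> = (\<Sum>t \<in> A \<times> A \<times> A \<times> A \<times> A \<times> A. card (Up t) * card (Lo t))"
    unfolding S_def using fin
    by (subst card_SigmaI) (auto simp: Up_def Lo_def I_def card_cartesian_product)
  finally show ?thesis
    using fin by (simp add: Up_def Lo_def I_def card_cartesian_product case_prod_unfold mult.assoc)
qed

section \<open>Monotone Boolean functions\<close>

lemma finite_cube: "finite (cube n)"
  by (simp add: cube_def finite_PiE)

lemma finite_mbf: "finite (mbf n)"
  by (rule finite_subset [of _ "cube n \<rightarrow>\<^sub>E UNIV"]) (auto simp: mbf_def finite_cube intro!: finite_PiE)

lemma cube_update: "u \<in> cube n \<Longrightarrow> u(n := x) \<in> cube (Suc n)"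
  by (auto simp: cube_def PiE_def extensional_def)

lemma cube_restrict: "v \<in> cube (Suc n) \<Longrightarrow> v(n := undefined) \<in> cube n"
  by (auto simp: cube_def PiE_def extensional_def less_Suc_eq)

lemma cube_undefined: "u \<in> cube n \<Longrightarrow> u(n := undefined) = u"
  by (auto simp: cube_def PiE_def extensional_def fun_eq_iff)

lemma mbfI:
  assumes "\<And>u v. u \<in> cube n \<Longrightarrow> v \<in> cube n \<Longrightarrow> u \<le> v \<Longrightarrow> f u \<le> f v"
    and "\<And>u. u \<notin> cube n \<Longrightarrow> f u = undefined"
  shows "f \<in> mbf n"
  using assms by (auto simp: mbf_def PiE_def extensional_def mono_on_def)

lemma mbf_mono: "f \<in> mbf n \<Longrightarrow> u \<in> cube n \<Longrightarrow> v \<in> cube n \<Longrightarrow> u \<le> v \<Longrightarrow> f u \<le> f v"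
  by (auto simp: mbf_def mono_on_def)

lemma mbf_monoD: "f \<in> mbf n \<Longrightarrow> f u \<Longrightarrow> u \<in> cube n \<Longrightarrow> v \<in> cube n \<Longrightarrow> u \<le> v \<Longrightarrow> f v"
  using mbf_mono [of f n u v] by simp

lemma mbf_undefined: "f \<in> mbf n \<Longrightarrow> u \<notin> cube n \<Longrightarrow> f u = undefined"
  by (auto simp: mbf_def PiE_def extensional_def)

lemma mbf_le_iff:
  assumes "f \<in> mbf n" "g \<in> mbf n"
  shows "f \<le> g \<longleftrightarrow> (\<forall>u \<in> cube n. f u \<le> g u)"
proof
  assume le: "\<forall>u \<in> cube n. f u \<le> g u"
  have "f u \<le> g u" for u
    using le assms by (cases "u \<in> cube n") (simp_all add: mbf_undefined)
  then show "f \<le> g"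
    by (rule le_funI)
qed (simp add: le_fun_def)

section \<open>Splitting off the last variable\<close>

definition mbf_split ::
    "nat \<Rightarrow> ((nat \<Rightarrow> bool) \<Rightarrow> bool) \<Rightarrow> ((nat \<Rightarrow> bool) \<Rightarrow> bool) \<times> ((nat \<Rightarrow> bool) \<Rightarrow> bool)" where
  "mbf_split n h = (\<lambda>u \<in> cube n. h (u(n := False)), \<lambda>u \<in> cube n. h (u(n := True)))"

text \<open>Monotonicity in variable \<open>n\<close> says exactly that the cofactor at
  \<open>False\<close> lies below the cofactor at \<open>True\<close>; monotonicity in the other
  variables is that of the two cofactors.\<close>

lemma order_iso_betw_mbf_split: "order_iso_betw (mbf_split n) (mbf (Suc n)) (chain_pairs (mbf n))"
proof -
  \<comment> \<open>Resetting coordinate \<open>n\<close> to \<open>undefined\<close> makes the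
    point extensional on \<open>{..<n}\<close> again, hence a point of
    \<open>cube n\<close>.\<close>
  define join :: "((nat \<Rightarrow> bool) \<Rightarrow> bool) \<times> ((nat \<Rightarrow> bool) \<Rightarrow> bool) \<Rightarrow> (nat \<Rightarrow> bool) \<Rightarrow> bool"
    where "join = (\<lambda>(f, g). \<lambda>v \<in> cube (Suc n). (if v n then g else f) (v(n := undefined)))"
  have restr: "(\<lambda>u \<in> cube n. h (u(n := x))) \<in> mbf n" if "h \<in> mbf (Suc n)" for h x
    using that by (intro mbfI) (auto simp: le_fun_def cube_update elim!: mbf_monoD)
  have le: "mbf_split n h \<le> mbf_split n k \<longleftrightarrow> h \<le> k" if h: "h \<in> mbf (Suc n)" and k: "k \<in> mbf (Suc n)" for h k
  proof
    assume le: "mbf_split n h \<le> mbf_split n k"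
    have "h v \<le> k v" if v: "v \<in> cube (Suc n)" for v
    proof -
      define u where "u = v(n := undefined)"
      have u: "u \<in> cube n" "v = u(n := v n)"
        using cube_restrict [OF v] by (auto simp: u_def)
      have "h (u(n := x)) \<le> k (u(n := x))" for x
        using le u(1) by (cases x) (auto simp: mbf_split_def le_fun_def dest!: spec [where x = u])
      then show ?thesis
        using u(2) by metis
    qed
    then show "h \<le> k"
      by (simp add: mbf_le_iff [OF h k])
  next
    assume "h \<le> k"
    then show "mbf_split n h \<le> mbf_split n k"
      by (auto simp: mbf_split_def le_fun_def)
  qed
  have split_mem: "mbf_split n h \<in> chain_pairs (mbf n)" if h: "h \<in> mbf (Suc n)" for h
    using restr [OF h] h
    by (auto simp: mbf_split_def mbf_le_iff cube_update le_fun_def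
        elim!: mbf_monoD)
  have join_mem: "join q \<in> mbf (Suc n)" if q: "q \<in> chain_pairs (mbf n)" for q
  proof -
    obtain f g where q': "q = (f, g)" "f \<in> mbf n" "g \<in> mbf n" "f \<le> g"
      using q by (auto simp: chain_pairs_def)
    show ?thesis
    proof (rule mbfI)
      fix u v assume uv: "u \<in> cube (Suc n)" "v \<in> cube (Suc n)" "u \<le> v"
      have r: "u(n := undefined) \<in> cube n" "v(n := undefined) \<in> cube n"
        "u(n := undefined) \<le> v(n := undefined)"
        using uv cube_restrict by (auto simp: le_fun_def)
      have f: "f (u(n := undefined)) \<le> f (v(n := undefined))"
        by (rule mbf_mono [OF q'(2) r])
      have g: "g (u(n := undefined)) \<le> g (v(n := undefined))"
        by (rule mbf_mono [OF q'(3) r])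
      \<comment> \<open>This covers the case where coordinate \<open>n\<close> rises from
        \<open>False\<close> to \<open>True\<close>: there \<open>join q\<close> passes from
        \<open>f\<close> to \<open>g\<close>.\<close>
      have "f (v(n := undefined)) \<le> g (v(n := undefined))" "u n \<le> v n"
        using q'(4) uv(3) by (auto simp: le_fun_def)
      then show "join q u \<le> join q v"
        using f g uv by (auto simp: join_def q'(1))
    qed (auto simp: join_def q'(1))
  qed
  have "mbf_split n (join q) = q" if "q \<in> chain_pairs (mbf n)" for q
    using that
    by (auto simp: mbf_split_def join_def fun_eq_iff restrict_def cube_update cube_undefined mbf_undefined
        chain_pairs_def)
  moreover have "join (mbf_split n h) = h" if "h \<in> mbf (Suc n)" for h
  proof
    fix v show "join (mbf_split n h) v = h v"
      \<comment> \<open>With the known value of \<open>v n\<close> inserted,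
        \<open>v(n := v n) = v\<close> identifies \<open>v\<close> with the point at which the
        matching cofactor evaluates \<open>h\<close>.\<close>
      using that fun_upd_triv [of v n]
      by (cases "v n"; cases "v \<in> cube (Suc n)")
        (auto simp: join_def mbf_split_def cube_restrict mbf_undefined simp del: fun_upd_triv)
  qed
  ultimately have "bij_betw (mbf_split n) (mbf (Suc n)) (chain_pairs (mbf n))"
    using split_mem join_mem by (intro bij_betw_byWitness [where f' = join]) auto
  then show ?thesis
    using le by (auto simp: order_iso_betw_def)
qed

lemma card_mbf_add_4: "card (mbf (n + 4)) = F_set n (mbf n \<times> mbf n \<times> mbf n \<times> mbf n \<times> mbf n \<times> mbf n)"
proof -
  note split = order_iso_betw_mbf_split
  note lift = order_iso_betw_chain_pairs [OF split]
  have "n + 4 = Suc (Suc (Suc (Suc n)))"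
    by simp
  then obtain \<phi> where "order_iso_betw \<phi> (mbf (n + 4))
      (chain_pairs (chain_pairs (chain_pairs (chain_pairs (mbf n)))))"
    \<comment> \<open>Four isomorphisms are composed: each splits off one more variable, inside
      zero, one, two and three layers of pairs respectively.\<close>
    using order_iso_betw_trans [OF split order_iso_betw_trans [OF lift order_iso_betw_trans
          [OF order_iso_betw_chain_pairs [OF lift]
            order_iso_betw_chain_pairs [OF order_iso_betw_chain_pairs [OF lift]]]]]
    by metis
  then have "card (mbf (n + 4)) = card (chain_pairs (chain_pairs (chain_pairs (chain_pairs (mbf n)))))"
    by (auto simp: order_iso_betw_def dest: bij_betw_same_card)
  then show ?thesis
    by (simp add: card_chain_pairs4 [OF finite_mbf] F_set_def F_def re_def)
qed

section \<open>Invariance under permutations of the variables\<close>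

lemma cube_comp_permutes:
  assumes "p permutes {..<n}"
  shows "u \<circ> p \<in> cube n \<longleftrightarrow> u \<in> cube n"
proof -
  have *: "u \<circ> q \<in> cube n" if "q permutes {..<n}" "u \<in> cube n" for q u
    using that permutes_not_in [OF that(1)] by (auto simp: cube_def PiE_def extensional_def)
  have "u \<circ> p \<circ> inv p = u"
    using permutes_inv_o [OF assms] by (simp add: comp_assoc)
  then show ?thesis
    using * [of p u] * [of "inv p" "u \<circ> p"] assms permutes_inv by metis
qed

lemma perm_act_mem:
  assumes "p permutes {..<n}" "f \<in> mbf n"
  shows "perm_act p f \<in> mbf n"
  using assms by (intro mbfI)
    (auto simp: perm_act_def cube_comp_permutes le_fun_def mbf_undefined
      elim!: mbf_monoD)

text \<open>Precomposition is applied twice, once to points and once to functions, so the two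
  reversals cancel and the action is a left action.\<close>

lemma perm_act_comp: "perm_act q (perm_act p f) = perm_act (q \<circ> p) f"
  by (simp add: perm_act_def fun_eq_iff comp_assoc)

lemma perm_act_id [simp]: "perm_act id f = f"
  by (simp add: perm_act_def fun_eq_iff)

lemma perm_act_inv:
  assumes "p permutes {..<n}"
  shows "perm_act (inv p) (perm_act p f) = f" "perm_act p (perm_act (inv p) f) = f"
  using assms by (simp_all add: perm_act_comp permutes_inv_o)

lemma perm_act_sup: "perm_act p (f \<squnion> g) = perm_act p f \<squnion> perm_act p g"
  by (simp add: perm_act_def fun_eq_iff)

lemma perm_act_inf: "perm_act p (f \<sqinter> g) = perm_act p f \<sqinter> perm_act p g"
  by (simp add: perm_act_def fun_eq_iff)

lemma perm_act_mono: "f \<le> g \<Longrightarrow> perm_act p f \<le> perm_act p g"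
  by (simp add: perm_act_def le_fun_def)

lemma perm_act_le_iff:
  assumes "p permutes {..<n}"
  shows "perm_act p f \<le> perm_act p g \<longleftrightarrow> f \<le> g"
  by (metis assms perm_act_inv(1) perm_act_mono)

text \<open>Serves to reindex both the intervals counted by \<open>re\<close> and the ranges of
  summation in \<open>F\<close>.\<close>

lemma bij_betw_perm_act_Collect:
  assumes p: "p permutes {..<n}" and "\<And>x. x \<in> mbf n \<Longrightarrow> Q (perm_act p x) \<longleftrightarrow> P x"
  shows "bij_betw (perm_act p) {x \<in> mbf n. P x} {x \<in> mbf n. Q x}"
proof (rule bij_betw_byWitness [where f' = "perm_act (inv p)"])
  show "perm_act (inv p) ` {x \<in> mbf n. Q x} \<subseteq> {x \<in> mbf n. P x}"
    using assms(2) [OF perm_act_mem [OF permutes_inv [OF p]]]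
    by (auto simp: perm_act_inv [OF p] perm_act_mem [OF permutes_inv [OF p]])
qed (use assms(2) perm_act_mem [OF p] in \<open>auto simp: perm_act_inv [OF p]\<close>)

lemma re_perm_act:
  assumes p: "p permutes {..<n}"
  shows "re n (perm_act p x) (perm_act p y) = re n x y"
  unfolding re_def
  by (rule bij_betw_same_card [symmetric], rule bij_betw_perm_act_Collect [OF p])
    (simp add: perm_act_le_iff [OF p])

lemma sum_perm_act:
  assumes p: "p permutes {..<n}"
    and "\<And>x. x \<in> mbf n \<Longrightarrow> Q (perm_act p x) \<longleftrightarrow> P x" "\<And>x. h (perm_act p x) = g x"
  shows "(\<Sum>x \<in> {x \<in> mbf n. Q x}. h x) = (\<Sum>x \<in> {x \<in> mbf n. P x}. g x)"
  using sum.reindex_bij_betw [OF bij_betw_perm_act_Collect [where P = P and Q = Q, OF p], of h] assms(2,3) by simp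

lemma F_perm_act:
  assumes p: "p permutes {..<n}"
  shows "F n (perm_act p a) (perm_act p b) (perm_act p c) (perm_act p d) (perm_act p e) (perm_act p f)
    = F n a b c d e f"
  \<comment> \<open>Read from right to left, the homomorphism laws turn every bound into the image
    of the original bound, so \<open>u\<close> can be replaced by
    \<open>perm_act p u\<close>.\<close>
  unfolding F_def perm_act_sup [symmetric] perm_act_inf [symmetric]
  by (rule arg_cong2 [where f = "(*)"]; rule sum_perm_act [OF p])
    (simp_all add: perm_act_le_iff [OF p] re_perm_act [OF p])

section \<open>Equivalence classes and canonical representatives\<close>

lemma equiv_mbf_equiv: "equiv (mbf n) (mbf_equiv n)"
proof (rule equivI)
  show "mbf_equiv n \<subseteq> mbf n \<times> mbf n"
    by (auto simp: mbf_equiv_def)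
  show "refl_on (mbf n) (mbf_equiv n)"
    by (auto simp: refl_on_def mbf_equiv_def intro!: exI [where x = id] permutes_id)
  show "sym (mbf_equiv n)"
    unfolding sym_def mbf_equiv_def using permutes_inv perm_act_inv(1) by (fastforce)
  show "trans (mbf_equiv n)"
    unfolding trans_def mbf_equiv_def using permutes_compose by (fastforce simp: perm_act_comp)
qed

lemma mbf_equiv_perm_act: "p permutes {..<n} \<Longrightarrow> f \<in> mbf n \<Longrightarrow> (perm_act p f, f) \<in> mbf_equiv n"
  by (auto simp: mbf_equiv_def perm_act_mem)

lemma gamma_cong: "(f, g) \<in> mbf_equiv n \<Longrightarrow> \<gamma> n f = \<gamma> n g"
  unfolding \<gamma>_def using equiv_class_eq [OF equiv_mbf_equiv] by metis

text \<open>Guarantees that every class has a canonical representative. The order is an arbitrary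
  relation \<open>r\<close>, unrelated to the pointwise order of functions.\<close>

lemma finite_linear_order_least:
  assumes r: "linear_order_on A r" and "finite C" "C \<noteq> {}" "C \<subseteq> A"
  shows "\<exists>a \<in> C. \<forall>b \<in> C. (a, b) \<in> r"
  using assms(2-)
proof (induction rule: finite_ne_induct)
  case (singleton x)
  then show ?case
    using r by (auto simp: order_on_defs refl_on_def)
next
  case (insert x C)
  then obtain a where a: "a \<in> C" "\<And>b. b \<in> C \<Longrightarrow> (a, b) \<in> r"
    by auto
  have refl: "(x, x) \<in> r" and tr: "trans r" and tot: "total_on A r" and xa: "x \<in> A" "a \<in> A"
    using r a(1) insert.prems by (auto simp: order_on_defs refl_on_def)
  have "(x, a) \<in> r \<or> (a, x) \<in> r"
    using tot xa refl by (cases "x = a") (auto simp: total_on_def)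
  then show ?case
  proof
    assume "(x, a) \<in> r"
    then have "\<forall>b \<in> insert x C. (x, b) \<in> r"
      using a(2) refl transD [OF tr] by blast
    then show ?thesis
      by blast
  next
    assume "(a, x) \<in> r"
    then show ?thesis
      using a by blast
  qed
qed

text \<open>Being closed under equivalence, \<open>X\<close> is the disjoint union of the classes of
  the representatives it contains, and \<open>w\<close> is constant on each of them. It is applied
  to \<open>E n m\<close>, where the factors \<gamma> are divisible by \<open>m\<close>, and to
  \<open>Ec n m\<close>.\<close>

lemma sum_class_representatives:
  fixes w :: "((nat \<Rightarrow> bool) \<Rightarrow> bool) \<Rightarrow> nat"
  assumes r: "linear_order_on (mbf n) r" and X: "X \<subseteq> mbf n"
    and closed: "\<And>a b. (a, b) \<in> mbf_equiv n \<Longrightarrow> a \<in> X \<Longrightarrow> b \<in> X"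
    and w: "\<And>a b. (a, b) \<in> mbf_equiv n \<Longrightarrow> a \<in> X \<Longrightarrow> w b = w a"
  shows "(\<Sum>x \<in> X. w x) = (\<Sum>a \<in> R n r \<inter> X. \<gamma> n a * w a)"
proof -
  let ?C = "\<lambda>a. mbf_equiv n `` {a}"
  note eq = equiv_mbf_equiv [of n]
  have fin: "finite X"
    using X finite_mbf finite_subset by blast
  have C: "?C a \<subseteq> mbf n" for a
    by (auto simp: mbf_equiv_def)
  \<comment> \<open>Membership in \<open>R n r\<close> makes \<open>a\<close> least in some class
    containing it, and that class can only be the class of \<open>a\<close>.\<close>
  have least: "\<forall>b \<in> ?C a. (a, b) \<in> r" if a: "a \<in> R n r" for a
    using a equiv_class_eq_iff [OF eq] unfolding R_def quotient_def by auto
  have X_eq: "X = (\<Union>a \<in> R n r \<inter> X. ?C a)"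
  proof (intro equalityI subsetI)
    fix x assume x: "x \<in> X"
    have xC: "x \<in> ?C x"
      using X x equiv_class_self [OF eq] by blast
    obtain a where a: "a \<in> ?C x" "\<forall>b \<in> ?C x. (a, b) \<in> r"
      using finite_linear_order_least [OF r finite_subset [OF C finite_mbf] _ C] xC by blast
    then have "a \<in> R n r"
      using X x by (auto simp: R_def intro!: quotientI bexI [where x = "?C x"])
    moreover have "(x, a) \<in> mbf_equiv n" "(a, x) \<in> mbf_equiv n"
      using a(1) eq by (auto simp: equiv_def dest: symD)
    ultimately show "x \<in> (\<Union>a \<in> R n r \<inter> X. ?C a)"
      using closed x by blast
  qed (use closed in auto)
  have disj: "?C a \<inter> ?C b = {}" if "a \<in> R n r" "b \<in> R n r" "a \<noteq> b" for a b
  proof (rule ccontr)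
    assume "?C a \<inter> ?C b \<noteq> {}"
    then have "(a, b) \<in> mbf_equiv n"
      using equiv_class_nondisjoint [OF eq] by blast
    then have "(a, b) \<in> r" "(b, a) \<in> r"
      using least that eq by (auto simp: equiv_def dest: symD)
    then show False
      using r that(3) by (auto simp: order_on_defs dest: antisymD)
  qed
  have "(\<Sum>x \<in> X. w x) = (\<Sum>a \<in> R n r \<inter> X. \<Sum>x \<in> ?C a. w x)"
    using sum.UNION_disjoint [of "R n r \<inter> X" ?C w] disj fin X_eq finite_subset [OF C finite_mbf] by auto
  also have "\<dots> = (\<Sum>a \<in> R n r \<inter> X. \<Sum>x \<in> ?C a. w a)"
    using w by (intro sum.cong refl) auto
  finally show ?thesis
    by (simp add: \<gamma>_def)
qed

lemma Ec_eq: "Ec n m = {f \<in> mbf n. \<not> [\<gamma> n f = 0] (mod m)}"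
  by (auto simp: Ec_def E_def)

lemma perm_act_mem_Ec_iff:
  assumes "p permutes {..<n}" "f \<in> mbf n"
  shows "perm_act p f \<in> Ec n m \<longleftrightarrow> f \<in> Ec n m"
  using assms gamma_cong [OF mbf_equiv_perm_act [OF assms]] by (simp add: Ec_eq perm_act_mem)

section \<open>Discarding the functions in \<open>E n m\<close>\<close>

abbreviation act6 where
  "act6 p \<equiv> (\<lambda>(a, b, c, d, e, f).
     (perm_act p a, perm_act p b, perm_act p c, perm_act p d, perm_act p e, perm_act p f))"

abbreviation F6 where
  "F6 n \<equiv> (\<lambda>(a, b, c, d, e, f). F n a b c d e f)"

text \<open>If \<open>a = perm_act p b\<close>, the diagonal action of \<open>p\<close> maps the
  fibre over \<open>b\<close> bijectively onto the fibre over \<open>a\<close> and preserves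
  \<open>F\<close>. Leaving \<pi> an arbitrary equivariant map lets one proof serve all six
  coordinates.\<close>

lemma sum_fibre_cong:
  assumes inv: "\<And>p t. p permutes {..<n} \<Longrightarrow> t \<in> W \<Longrightarrow> act6 p t \<in> W"
    and proj: "\<And>p t. \<pi> (act6 p t) = perm_act p (\<pi> t)"
    and ab: "(a, b) \<in> mbf_equiv n"
  shows "(\<Sum>t \<in> {t \<in> W. \<pi> t = b}. F6 n t) = (\<Sum>t \<in> {t \<in> W. \<pi> t = a}. F6 n t)"
proof -
  obtain p where p: "p permutes {..<n}" and a: "a = perm_act p b"
    using ab by (auto simp: mbf_equiv_def)
  note p' = permutes_inv [OF p]
  have inverse: "act6 (inv p) (act6 p t) = t" "act6 p (act6 (inv p) t) = t" for t
    by (cases t; simp add: perm_act_inv [OF p])+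
  show ?thesis
  proof (rule sum.reindex_bij_witness [where i = "act6 (inv p)" and j = "act6 p"])
    fix t assume t: "t \<in> {t \<in> W. \<pi> t = b}"
    show "act6 (inv p) (act6 p t) = t"
      by (rule inverse)
    show "act6 p t \<in> {t \<in> W. \<pi> t = a}"
      using t inv [OF p] proj [of p] by (simp only: mem_Collect_eq a)
    show "F6 n (act6 p t) = F6 n t"
      by (cases t) (simp add: F_perm_act [OF p])
  next
    fix t assume t: "t \<in> {t \<in> W. \<pi> t = a}"
    show "act6 p (act6 (inv p) t) = t"
      by (rule inverse)
    show "act6 (inv p) t \<in> {t \<in> W. \<pi> t = b}"
      using t inv [OF p'] proj [of "inv p"] by (simp only: mem_Collect_eq a perm_act_inv [OF p])
  qed
qed

text \<open>The discarded tuples are grouped by the value of \<pi>. Their total is a sum over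
  representatives \<open>a\<close> in \<open>E n m\<close> of multiples of
  \<open>\<gamma> n a\<close>, each divisible by \<open>m\<close>.\<close>

lemma sum_restrict_Ec_cong:
  assumes r: "linear_order_on (mbf n) r" and fin: "finite W"
    and inv: "\<And>p t. p permutes {..<n} \<Longrightarrow> t \<in> W \<Longrightarrow> act6 p t \<in> W"
    and proj: "\<And>p t. \<pi> (act6 p t) = perm_act p (\<pi> t)"
    and mem: "\<And>t. t \<in> W \<Longrightarrow> \<pi> t \<in> mbf n"
  shows "[(\<Sum>t \<in> W. F6 n t) = (\<Sum>t \<in> {t \<in> W. \<pi> t \<in> Ec n m}. F6 n t)] (mod m)"
proof -
  let ?w = "\<lambda>x. \<Sum>t \<in> {t \<in> W. \<pi> t = x}. F6 n t"
  let ?V = "{t \<in> W. \<pi> t \<in> E n m}"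
  have E: "E n m \<subseteq> mbf n" "finite (E n m)"
    using finite_mbf by (auto simp: E_def)
  have "(\<Sum>t \<in> ?V. F6 n t) = (\<Sum>x \<in> E n m. \<Sum>t \<in> {t \<in> ?V. \<pi> t = x}. F6 n t)"
    using fin E(2) by (intro sum.group [symmetric]) auto
  also have "\<dots> = (\<Sum>x \<in> E n m. ?w x)"
    by (intro sum.cong) auto
  also have "\<dots> = (\<Sum>a \<in> R n r \<inter> E n m. \<gamma> n a * ?w a)"
  proof (rule sum_class_representatives [OF r E(1)])
    fix a b assume ab: "(a, b) \<in> mbf_equiv n"
    show "?w b = ?w a"
      by (rule sum_fibre_cong [OF inv proj ab])
    show "b \<in> E n m" if "a \<in> E n m"
      using that ab gamma_cong [OF ab] by (auto simp: E_def mbf_equiv_def)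
  qed
  also have "[\<dots> = 0] (mod m)"
    by (auto simp: cong_0_iff E_def intro!: dvd_sum dvd_mult2)
  finally have V: "[(\<Sum>t \<in> ?V. F6 n t) = 0] (mod m)" .
  have "W = ?V \<union> {t \<in> W. \<pi> t \<in> Ec n m}" "?V \<inter> {t \<in> W. \<pi> t \<in> Ec n m} = {}"
    using mem by (auto simp: Ec_def)
  then have "(\<Sum>t \<in> W. F6 n t) = (\<Sum>t \<in> ?V. F6 n t) + (\<Sum>t \<in> {t \<in> W. \<pi> t \<in> Ec n m}. F6 n t)"
    using fin by (metis (no_types, lifting) sum.union_disjoint finite_Un)
  then show ?thesis
    using cong_add [OF V cong_refl] by simp
qed

lemma F_set_mbf_cong_Ec:
  assumes r: "linear_order_on (mbf n) r"
  shows "[F_set n (mbf n \<times> mbf n \<times> mbf n \<times> mbf n \<times> mbf n \<times> mbf n) =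
      F_set n (Ec n m \<times> Ec n m \<times> Ec n m \<times> Ec n m \<times> Ec n m \<times> Ec n m)] (mod m)"
proof -
  note cong_trans [trans]
  let ?D = "mbf n" and ?G = "Ec n m"
  have G: "?G \<subseteq> ?D"
    by (auto simp: Ec_def)
  have mem: "perm_act p x \<in> ?D" "x \<in> ?G \<Longrightarrow> perm_act p x \<in> ?G" if "p permutes {..<n}" "x \<in> ?D" for p x
    using that perm_act_mem_Ec_iff perm_act_mem by auto
  \<comment> \<open>Both \<open>mbf n\<close> and \<open>Ec n m\<close> are stable under
    permutations, so any product mixing them is stable under the diagonal action. This allows the
    coordinates to be treated in turn.\<close>
  have step: "[F_set n W = F_set n W'] (mod m)"
    if "W = A \<times> B \<times> C \<times> D \<times> J \<times> K" "set [A, B, C, D, J, K] \<subseteq> {?D, ?G}"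
      and "\<And>p t. \<pi> (act6 p t) = perm_act p (\<pi> t)" "\<And>t. t \<in> W \<Longrightarrow> \<pi> t \<in> mbf n"
      and "W' = {t \<in> W. \<pi> t \<in> ?G}"
    for W W' A B C D J K \<pi>
  proof -
    have sub: "X = ?D \<or> X = ?G" if "X \<in> {A, B, C, D, J, K}" for X
      using that \<open>set [A, B, C, D, J, K] \<subseteq> {?D, ?G}\<close> by auto
    have act: "perm_act p x \<in> X" if "X \<in> {A, B, C, D, J, K}" "p permutes {..<n}" "x \<in> X" for X p x
      using sub [OF that(1)] mem [OF that(2)] that(3) G by blast
    have "finite X" if "X \<in> {A, B, C, D, J, K}" for X
      using sub [OF that] finite_mbf [of n] finite_subset [OF G] by auto
    then have "finite W"
      by (simp add: that(1))
    moreover have "act6 p t \<in> W" if "p permutes {..<n}" "t \<in> W" for p t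
      using that act [OF _ that(1)] by (auto simp: \<open>W = _\<close>)
    ultimately show ?thesis
      unfolding F_set_def that(5) using that(3,4) by (intro sum_restrict_Ec_cong [OF r])
  qed
  have "[F_set n (?D \<times> ?D \<times> ?D \<times> ?D \<times> ?D \<times> ?D) = F_set n (?G \<times> ?D \<times> ?D \<times> ?D \<times> ?D \<times> ?D)] (mod m)"
    using G by (intro step [where \<pi> = fst]) auto
  also have "[F_set n (?G \<times> ?D \<times> ?D \<times> ?D \<times> ?D \<times> ?D) = F_set n (?G \<times> ?G \<times> ?D \<times> ?D \<times> ?D \<times> ?D)] (mod m)"
    using G by (intro step [where \<pi> = "fst \<circ> snd"]) auto
  also have "[F_set n (?G \<times> ?G \<times> ?D \<times> ?D \<times> ?D \<times> ?D) = F_set n (?G \<times> ?G \<times> ?G \<times> ?D \<times> ?D \<times> ?D)] (mod m)"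
    using G by (intro step [where \<pi> = "fst \<circ> snd \<circ> snd"]) auto
  also have "[F_set n (?G \<times> ?G \<times> ?G \<times> ?D \<times> ?D \<times> ?D) = F_set n (?G \<times> ?G \<times> ?G \<times> ?G \<times> ?D \<times> ?D)] (mod m)"
    using G by (intro step [where \<pi> = "fst \<circ> snd \<circ> snd \<circ> snd"]) auto
  also have "[F_set n (?G \<times> ?G \<times> ?G \<times> ?G \<times> ?D \<times> ?D) = F_set n (?G \<times> ?G \<times> ?G \<times> ?G \<times> ?G \<times> ?D)] (mod m)"
    using G by (intro step [where \<pi> = "fst \<circ> snd \<circ> snd \<circ> snd \<circ> snd"]) auto
  also have "[F_set n (?G \<times> ?G \<times> ?G \<times> ?G \<times> ?G \<times> ?D) = F_set n (?G \<times> ?G \<times> ?G \<times> ?G \<times> ?G \<times> ?G)] (mod m)"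
    using G by (intro step [where \<pi> = "snd \<circ> snd \<circ> snd \<circ> snd \<circ> snd"]) auto
  finally show ?thesis .
qed

text \<open>An exact equality, as no class is dropped. Only the first coordinate is reduced: the
  action is diagonal, so bringing \<open>a\<close> to its representative moves the other five as
  well.\<close>

lemma F_set_Ec_representatives:
  assumes r: "linear_order_on (mbf n) r"
  shows "F_set n (Ec n m \<times> Ec n m \<times> Ec n m \<times> Ec n m \<times> Ec n m \<times> Ec n m) =
    (\<Sum>a \<in> R n r \<inter> Ec n m.
       \<Sum>(b, c, d, e, f) \<in> Ec n m \<times> Ec n m \<times> Ec n m \<times> Ec n m \<times> Ec n m. \<gamma> n a * F n a b c d e f)"
proof -
  let ?G = "Ec n m"
  let ?H = "?G \<times> ?G \<times> ?G \<times> ?G \<times> ?G"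
  let ?w = "\<lambda>a. \<Sum>(b, c, d, e, f) \<in> ?H. F n a b c d e f"
  have G: "?G \<subseteq> mbf n"
    by (auto simp: Ec_def)
  \<comment> \<open>The inner sum is rewritten as a sum over the fibre of \<open>fst\<close>, the
    form in which invariance under the diagonal action applies.\<close>
  have fibre: "?w a = (\<Sum>t \<in> {t \<in> ?G \<times> ?H. fst t = a}. F6 n t)" if "a \<in> ?G" for a
    using that by (intro sum.reindex_bij_witness [where i = snd and j = "Pair a"]) auto
  have "F_set n (?G \<times> ?H) = (\<Sum>a \<in> ?G. ?w a)"
    unfolding F_set_def by (subst sum.cartesian_product [symmetric]) (auto intro!: sum.cong)
  also have "\<dots> = (\<Sum>a \<in> R n r \<inter> ?G. \<gamma> n a * ?w a)"
  proof (rule sum_class_representatives [OF r G])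
    fix a b assume ab: "(a, b) \<in> mbf_equiv n" and a: "a \<in> ?G"
    show b: "b \<in> ?G"
      using a ab gamma_cong [OF ab] by (auto simp: Ec_eq mbf_equiv_def)
    show "?w b = ?w a"
      unfolding fibre [OF a] fibre [OF b] using G
      by (intro sum_fibre_cong [OF _ _ ab]) (auto simp: perm_act_mem_Ec_iff subset_iff)
  qed
  finally show ?thesis
    by (simp add: sum_distrib_left case_prod_unfold)
qed

unbundle no lattice_syntax

theorem theorem14:
  fixes n m :: nat and r :: "((nat \<Rightarrow> bool) \<Rightarrow> bool) rel"
  assumes "m > 1"
    and "linear_order_on (mbf n) r"
  shows "[card (mbf (n + 4)) = F_set n (mbf n \<times> mbf n \<times> mbf n \<times> mbf n \<times> mbf n \<times> mbf n)] (mod m) \<and>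
    [F_set n (mbf n \<times> mbf n \<times> mbf n \<times> mbf n \<times> mbf n \<times> mbf n) =
      F_set n (Ec n m \<times> Ec n m \<times> Ec n m \<times> Ec n m \<times> Ec n m \<times> Ec n m)] (mod m) \<and>
    [card (mbf (n + 4)) =
      (\<Sum>a \<in> R n r \<inter> Ec n m.
         \<Sum>(b, c, d, e, f) \<in> Ec n m \<times> Ec n m \<times> Ec n m \<times> Ec n m \<times> Ec n m. \<gamma> n a * F n a b c d e f)] (mod m)"
  using F_set_mbf_cong_Ec [OF assms(2), of m] F_set_Ec_representatives [OF assms(2), of m]
  by (simp add: card_mbf_add_4)

end
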